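(* Let $T$ be a complete first-order theory, let $\varphi(x;y)$ be a formula of $T$ without the independence property (i.e. $\varphi$ is NIP), let $\langle P_n : n<\omega\rangle$ be the characteristic sequence of $\varphi$, and let $A$ be a positive base set for $\varphi$. Then for each $n<\omega$, $P_n$-empty tuples are not persistent around $A$.
   Context: $T$ is a complete theory in a language $\mathcal{L}$; $x,y$ may be tuples of variables. Everything is computed in a fixed sufficiently saturated (monster) model $M$ of $T$. Characteristic sequence: $P_n(z_1,\dots,z_n) := \exists x \bigwedge_{i\le n}\varphi(x;z_i)$ for $n\geq 1$. The formulas $P_n$ are identified with their interpretations in $M$; $P_1$ also denotes the set it defines. $P_n$ is symmetric, and whether it holds depends only on the set of its arguments (repetitions allowed). Standing convention: $T\vdash \forall y\exists z\forall x(\varphi(x;z)\leftrightarrow\neg\varphi(x;y))$; if a formula $\chi(x;y)$ does not satisfy this it is replaced by $\theta(x;y,z)=\chi(x;y)\wedge\neg\chi(x;z)$. Thus $\varphi$ either satisfies this condition or is of the form $\chi(x;y)\wedge\neg\chi(x;z)$. A set $A\subset P_1$ (small, possibly empty) is a $P_n$-complete graph if $P_n$ holds on every $n$-tuple from $A$. It is a positive base set (equivalently, a $P_\infty$-complete graph) if it is a $P_n$-complete graph for all $n$; equivalently $\{\varphi(x;a):a\in A\}$ is consistent. Localization: let $A$ be a positive base set and $B\subset M$. A localization $P^f_1$ of $P_1$ around $A$ with parameters from $B$ is a formula $P^f_1(y)=\bigwedge_{i<m}P_{r_i}(\check\sigma_i,\check\beta_i)$, where $m<\omega$, each $\sigma_i\subseteq\{y\}$,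 each $\beta_i$ is a finite subset of $B$, and $\check\sigma_i,\check\beta_i$ list the elements of these sets (with repetitions if needed to fill the $r_i$ places), such that: (nontriviality) for each $\ell<\omega$ there is a (nonempty) $P_\ell$-complete graph $C_\ell$ with $P^f_1$ holding on all elements of $C_\ell$; and $P^f_1$ holds on all elements of $A$. $P^f_1$ also denotes the set defined. A $P_n$-empty tuple is a tuple $y_1,\dots,y_n\in P_1$ with $\neg P_n(y_1,\dots,y_n)$. $P_n$-empty tuples are persistent around $A$ if for every finite $B\subset M$, every localization $P^f_1$ of $P_1$ around $A$ with parameters from $B$ contains a $P_n$-empty tuple (all $y_i\in P^f_1$; the predicate $P_n$ is the original one, not a localized one).
   Formalization: Assumes in addition that P_1 is nonempty; if P_1 is empty (e.g. φ = χ(x;y) ∧ ¬χ(x;z) with χ being x = x) then A is empty, no localization exists, persistence holds vacuously and the claim fails. *)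

theory Defs
  imports Main
begin

section \<open>First-order logic with equality\<close>

datatype 'f tm = Var nat | Fn 'f "'f tm list"

datatype ('f, 'r) fm =
    Eq "'f tm" "'f tm"
  | Rel 'r "'f tm list"
  | Neg "('f, 'r) fm"
  | Conj "('f, 'r) fm" "('f, 'r) fm"
  | Exists nat "('f, 'r) fm"

text \<open>The symbols of a language are paired with their arities.\<close>

record ('f, 'r) lang =
  Funs :: "('f \<times> nat) set"
  Rels :: "('r \<times> nat) set"

fun tm_in :: "('f, 'r) lang \<Rightarrow> 'f tm \<Rightarrow> bool" where
  "tm_in L (Var v) \<longleftrightarrow> True"
| "tm_in L (Fn f ts) \<longleftrightarrow> (f, length ts) \<in> Funs L \<and> (\<forall>t \<in> set ts. tm_in L t)"

fun fm_in :: "('f, 'r) lang \<Rightarrow> ('f, 'r) fm \<Rightarrow> bool" where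
  "fm_in L (Eq s t) \<longleftrightarrow> tm_in L s \<and> tm_in L t"
| "fm_in L (Rel r ts) \<longleftrightarrow> (r, length ts) \<in> Rels L \<and> (\<forall>t \<in> set ts. tm_in L t)"
| "fm_in L (Neg p) \<longleftrightarrow> fm_in L p"
| "fm_in L (Conj p q) \<longleftrightarrow> fm_in L p \<and> fm_in L q"
| "fm_in L (Exists v p) \<longleftrightarrow> fm_in L p"

definition formulas :: "('f, 'r) lang \<Rightarrow> ('f, 'r) fm set" where
  "formulas L = {p. fm_in L p}"

fun tm_vars :: "'f tm \<Rightarrow> nat set" where
  "tm_vars (Var v) = {v}"
| "tm_vars (Fn f ts) = (\<Union>t \<in> set ts. tm_vars t)"

fun fv :: "('f, 'r) fm \<Rightarrow> nat set" where
  "fv (Eq s t) = tm_vars s \<union> tm_vars t"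
| "fv (Rel r ts) = (\<Union>t \<in> set ts. tm_vars t)"
| "fv (Neg p) = fv p"
| "fv (Conj p q) = fv p \<union> fv q"
| "fv (Exists v p) = fv p - {v}"

definition sentences :: "('f, 'r) lang \<Rightarrow> ('f, 'r) fm set" where
  "sentences L = {p \<in> formulas L. fv p = {}}"

fun tm_rename :: "(nat \<Rightarrow> nat) \<Rightarrow> 'f tm \<Rightarrow> 'f tm" where
  "tm_rename \<pi> (Var v) = Var (\<pi> v)"
| "tm_rename \<pi> (Fn f ts) = Fn f (map (tm_rename \<pi>) ts)"

text \<open>Bound variables are renamed along with the free ones, so that renaming by a bijection
  cannot capture variables.\<close>

fun rename :: "(nat \<Rightarrow> nat) \<Rightarrow> ('f, 'r) fm \<Rightarrow> ('f, 'r) fm" where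
  "rename \<pi> (Eq s t) = Eq (tm_rename \<pi> s) (tm_rename \<pi> t)"
| "rename \<pi> (Rel r ts) = Rel r (map (tm_rename \<pi>) ts)"
| "rename \<pi> (Neg p) = Neg (rename \<pi> p)"
| "rename \<pi> (Conj p q) = Conj (rename \<pi> p) (rename \<pi> q)"
| "rename \<pi> (Exists v p) = Exists (\<pi> v) (rename \<pi> p)"

record ('m, 'f, 'r) interp =
  Univ :: "'m set"
  FunI :: "'f \<Rightarrow> 'm list \<Rightarrow> 'm"
  RelI :: "'r \<Rightarrow> 'm list \<Rightarrow> bool"

definition tuples :: "'m set \<Rightarrow> nat \<Rightarrow> 'm list set" where
  "tuples U k = {a. set a \<subseteq> U \<and> length a = k}"

definition is_structure :: "('f, 'r) lang \<Rightarrow> ('m, 'f, 'r) interp \<Rightarrow> bool" where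
  "is_structure L M \<longleftrightarrow> Univ M \<noteq> {} \<and>
     (\<forall>(f, k) \<in> Funs L. \<forall>a \<in> tuples (Univ M) k. FunI M f a \<in> Univ M)"

fun tm_val :: "('m, 'f, 'r) interp \<Rightarrow> (nat \<Rightarrow> 'm) \<Rightarrow> 'f tm \<Rightarrow> 'm" where
  "tm_val M s (Var v) = s v"
| "tm_val M s (Fn f ts) = FunI M f (map (tm_val M s) ts)"

fun sat :: "('m, 'f, 'r) interp \<Rightarrow> (nat \<Rightarrow> 'm) \<Rightarrow> ('f, 'r) fm \<Rightarrow> bool" where
  "sat M s (Eq t u) \<longleftrightarrow> tm_val M s t = tm_val M s u"
| "sat M s (Rel r ts) \<longleftrightarrow> RelI M r (map (tm_val M s) ts)"
| "sat M s (Neg p) \<longleftrightarrow> \<not> sat M s p"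
| "sat M s (Conj p q) \<longleftrightarrow> sat M s p \<and> sat M s q"
| "sat M s (Exists v p) \<longleftrightarrow> (\<exists>m \<in> Univ M. sat M (s(v := m)) p)"

definition is_model :: "('m, 'f, 'r) interp \<Rightarrow> ('f, 'r) fm set \<Rightarrow> bool" where
  "is_model M T \<longleftrightarrow> (\<forall>p \<in> T. \<forall>s. range s \<subseteq> Univ M \<longrightarrow> sat M s p)"

text \<open>Consequence is defined through structures whose universe is a subset of the type of all
  formulas. That type is infinite and at least as large as the language, so by the downward
  Loewenheim-Skolem theorem no countermodel is lost and this is consequence over all
  structures (equivalently, provability).\<close>

definition small_model ::
  "('f, 'r) lang \<Rightarrow> ('f, 'r) fm set \<Rightarrow> (('f, 'r) fm, 'f, 'r) interp \<Rightarrow> bool" where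
  "small_model L T N \<longleftrightarrow> is_structure L N \<and> is_model N T"

definition entails :: "('f, 'r) lang \<Rightarrow> ('f, 'r) fm set \<Rightarrow> ('f, 'r) fm \<Rightarrow> bool" where
  "entails L T p \<longleftrightarrow> (\<forall>N. small_model L T N \<longrightarrow> is_model N {p})"

definition complete_theory :: "('f, 'r) lang \<Rightarrow> ('f, 'r) fm set \<Rightarrow> bool" where
  "complete_theory L T \<longleftrightarrow> T \<subseteq> sentences L \<and> (\<exists>N. small_model L T N) \<and>
     (\<forall>p \<in> sentences L. entails L T p \<or> entails L T (Neg p))"

text \<open>A formula in the type variables \<open>v\<^sub>0, \<dots>, v\<^sub>k\<^sub>-\<^sub>1\<close> with parameters from \<open>C\<close> is a pair
  \<open>(p, c)\<close>, where the tuple \<open>c\<close> is substituted for the variables from \<open>v\<^sub>k\<close> on. Types in any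
  finite number \<open>k\<close> of variables are considered; they need not be complete.\<close>

definition param_formulas ::
  "('f, 'r) lang \<Rightarrow> 'm set \<Rightarrow> nat \<Rightarrow> (('f, 'r) fm \<times> 'm list) set" where
  "param_formulas L C k = {(p, c). p \<in> formulas L \<and> set c \<subseteq> C \<and> fv p \<subseteq> {..<k + length c}}"

definition realizes ::
  "('m, 'f, 'r) interp \<Rightarrow> 'm list \<Rightarrow> (('f, 'r) fm \<times> 'm list) set \<Rightarrow> bool" where
  "realizes M d q \<longleftrightarrow> (\<forall>(p, c) \<in> q. sat M (\<lambda>v. (d @ c) ! v) p)"

definition saturated :: "('f, 'r) lang \<Rightarrow> 'k rel \<Rightarrow> ('m, 'f, 'r) interp \<Rightarrow> bool" where
  "saturated L \<kappa> M \<longleftrightarrow>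
     (\<forall>C k q. C \<subseteq> Univ M \<and> (card_of C, \<kappa>) \<in> ordLess \<and> q \<subseteq> param_formulas L C k \<and>
        (\<forall>q0. finite q0 \<and> q0 \<subseteq> q \<longrightarrow> (\<exists>d \<in> tuples (Univ M) k. realizes M d q0))
        \<longrightarrow> (\<exists>d \<in> tuples (Univ M) k. realizes M d q))"


section \<open>Partitioned formulas\<close>

text \<open>A formula \<open>\<phi>(x; y)\<close> together with the tuples of variables \<open>x\<close> and \<open>y\<close>.\<close>

record ('f, 'r) pform =
  body :: "('f, 'r) fm"
  xvars :: "nat list"
  yvars :: "nat list"

definition is_pform :: "('f, 'r) lang \<Rightarrow> ('f, 'r) pform \<Rightarrow> bool" where
  "is_pform L \<phi> \<longleftrightarrow> body \<phi> \<in> formulas L \<and> distinct (xvars \<phi> @ yvars \<phi>) \<and>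
     fv (body \<phi>) \<subseteq> set (xvars \<phi> @ yvars \<phi>)"

definition holds ::
  "('m, 'f, 'r) interp \<Rightarrow> ('f, 'r) pform \<Rightarrow> 'm list \<Rightarrow> 'm list \<Rightarrow> bool" where
  "holds M \<phi> a b \<longleftrightarrow> sat M (\<lambda>v. the (map_of (zip (xvars \<phi> @ yvars \<phi>) (a @ b)) v)) (body \<phi>)"

definition xtuples :: "('m, 'f, 'r) interp \<Rightarrow> ('f, 'r) pform \<Rightarrow> 'm list set" where
  "xtuples M \<phi> = tuples (Univ M) (length (xvars \<phi>))"

definition ytuples :: "('m, 'f, 'r) interp \<Rightarrow> ('f, 'r) pform \<Rightarrow> 'm list set" where
  "ytuples M \<phi> = tuples (Univ M) (length (yvars \<phi>))"

text \<open>\<open>T \<turnstile> \<forall>y \<exists>z \<forall>x (\<phi>(x; z) \<leftrightarrow> \<not> \<phi>(x; y))\<close>\<close>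

definition negation_closed ::
  "('f, 'r) lang \<Rightarrow> ('f, 'r) fm set \<Rightarrow> ('f, 'r) pform \<Rightarrow> bool" where
  "negation_closed L T \<phi> \<longleftrightarrow> (\<forall>N. small_model L T N \<longrightarrow>
     (\<forall>b \<in> ytuples N \<phi>. \<exists>c \<in> ytuples N \<phi>. \<forall>a \<in> xtuples N \<phi>. holds N \<phi> a c \<longleftrightarrow> \<not> holds N \<phi> a b))"

text \<open>\<open>\<phi>(x; y, z) = \<chi>(x; y) \<and> \<not> \<chi>(x; z)\<close>: here \<open>\<chi>(x; z)\<close> arises from \<open>\<chi>(x; y)\<close> by a
  permutation of the variables which fixes \<open>x\<close> and takes \<open>y\<close> to \<open>z\<close>.\<close>

definition is_difference :: "('f, 'r) lang \<Rightarrow> ('f, 'r) pform \<Rightarrow> bool" where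
  "is_difference L \<phi> \<longleftrightarrow> (\<exists>\<chi> \<pi>. is_pform L \<chi> \<and> bij \<pi> \<and> map \<pi> (xvars \<chi>) = xvars \<chi> \<and>
     xvars \<phi> = xvars \<chi> \<and> yvars \<phi> = yvars \<chi> @ map \<pi> (yvars \<chi>) \<and>
     body \<phi> = Conj (body \<chi>) (Neg (rename \<pi> (body \<chi>))))"

definition standing_convention ::
  "('f, 'r) lang \<Rightarrow> ('f, 'r) fm set \<Rightarrow> ('f, 'r) pform \<Rightarrow> bool" where
  "standing_convention L T \<phi> \<longleftrightarrow> negation_closed L T \<phi> \<or> is_difference L \<phi>"

definition has_IP :: "('m, 'f, 'r) interp \<Rightarrow> ('f, 'r) pform \<Rightarrow> bool" where
  "has_IP M \<phi> \<longleftrightarrow> (\<forall>k::nat. \<exists>b. (\<forall>i<k. b i \<in> ytuples M \<phi>) \<and>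
     (\<forall>S \<subseteq> {..<k}. \<exists>a \<in> xtuples M \<phi>. \<forall>i<k. holds M \<phi> a (b i) \<longleftrightarrow> i \<in> S))"

abbreviation NIP :: "('m, 'f, 'r) interp \<Rightarrow> ('f, 'r) pform \<Rightarrow> bool" where
  "NIP M \<phi> \<equiv> \<not> has_IP M \<phi>"


section \<open>The characteristic sequence\<close>

definition char_seq ::
  "('m, 'f, 'r) interp \<Rightarrow> ('f, 'r) pform \<Rightarrow> nat \<Rightarrow> 'm list list \<Rightarrow> bool" where
  "char_seq M \<phi> n zs \<longleftrightarrow> length zs = n \<and> set zs \<subseteq> ytuples M \<phi> \<and>
     (\<exists>a \<in> xtuples M \<phi>. \<forall>z \<in> set zs. holds M \<phi> a z)"

definition P1 :: "('m, 'f, 'r) interp \<Rightarrow> ('f, 'r) pform \<Rightarrow> 'm list set" where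
  "P1 M \<phi> = {z. char_seq M \<phi> 1 [z]}"

definition complete_graph ::
  "('m, 'f, 'r) interp \<Rightarrow> ('f, 'r) pform \<Rightarrow> nat \<Rightarrow> 'm list set \<Rightarrow> bool" where
  "complete_graph M \<phi> n A \<longleftrightarrow> A \<subseteq> P1 M \<phi> \<and>
     (\<forall>zs. length zs = n \<and> set zs \<subseteq> A \<longrightarrow> char_seq M \<phi> n zs)"

definition positive_base_set ::
  "('m, 'f, 'r) interp \<Rightarrow> ('f, 'r) pform \<Rightarrow> 'm list set \<Rightarrow> bool" where
  "positive_base_set M \<phi> A \<longleftrightarrow> (\<forall>n. complete_graph M \<phi> n A)"

text \<open>A localization is a list of conjuncts; a conjunct \<open>P\<^sub>r(\<dots>)\<close> is given by the list of its
  \<open>r \<ge> 1\<close> arguments, each of which is the variable \<open>y\<close> or a parameter. The order and the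
  repetitions in this list are immaterial for \<open>P\<^sub>r\<close>. Parameters from \<open>B\<close> are tuples of the
  length of \<open>y\<close> with coordinates in \<open>B\<close>.\<close>

datatype 'm loc_arg = Yvar | Par "'m list"

primrec loc_val :: "'m list \<Rightarrow> 'm loc_arg \<Rightarrow> 'm list" where
  "loc_val y Yvar = y"
| "loc_val y (Par b) = b"

definition loc_set ::
  "('m, 'f, 'r) interp \<Rightarrow> ('f, 'r) pform \<Rightarrow> 'm loc_arg list list \<Rightarrow> 'm list set" where
  "loc_set M \<phi> F = {y \<in> ytuples M \<phi>. \<forall>c \<in> set F. char_seq M \<phi> (length c) (map (loc_val y) c)}"

definition is_localization ::
  "('m, 'f, 'r) interp \<Rightarrow> ('f, 'r) pform \<Rightarrow> 'm list set \<Rightarrow> 'm set \<Rightarrow>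
     'm loc_arg list list \<Rightarrow> bool" where
  "is_localization M \<phi> A B F \<longleftrightarrow>
     (\<forall>c \<in> set F. c \<noteq> [] \<and> (\<forall>b. Par b \<in> set c \<longrightarrow> b \<in> tuples B (length (yvars \<phi>)))) \<and>
     (\<forall>l. \<exists>C. C \<noteq> {} \<and> complete_graph M \<phi> l C \<and> C \<subseteq> loc_set M \<phi> F) \<and>
     A \<subseteq> loc_set M \<phi> F"

definition empty_tuple ::
  "('m, 'f, 'r) interp \<Rightarrow> ('f, 'r) pform \<Rightarrow> nat \<Rightarrow> 'm list list \<Rightarrow> bool" where
  "empty_tuple M \<phi> n zs \<longleftrightarrow> length zs = n \<and> set zs \<subseteq> P1 M \<phi> \<and> \<not> char_seq M \<phi> n zs"

definition empty_tuples_persistent ::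
  "('m, 'f, 'r) interp \<Rightarrow> ('f, 'r) pform \<Rightarrow> nat \<Rightarrow> 'm list set \<Rightarrow> bool" where
  "empty_tuples_persistent M \<phi> n A \<longleftrightarrow>
     (\<forall>B F. finite B \<and> B \<subseteq> Univ M \<and> is_localization M \<phi> A B F \<longrightarrow>
        (\<exists>zs. empty_tuple M \<phi> n zs \<and> set zs \<subseteq> loc_set M \<phi> F))"

end

theory Submission
  imports Defs
begin

text \<open>
  Call a set of parameters consistent if the instances of \<open>\<phi>\<close> at its elements have a common
  realization. Suppose that \<open>P\<^sub>n\<close>-empty tuples are persistent around \<open>A\<close>, which may be taken
  nonempty by adding a point of \<open>P\<^sub>1\<close>; the independence property is derived as follows.

  Let \<open>E\<close> range over the finite sets of parameters such that \<open>A \<union> E\<close> is finitely consistent.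
  The formula \<open>P\<^sub>r(y, E)\<close> then holds on all of \<open>A\<close>, so finitely many such sets always cut out a
  localization around \<open>A\<close> (\<open>ex_localization\<close>). Persistence therefore provides, for any finite
  family of sets \<open>E\<close>, an \<open>n\<close>-tuple inconsistent as a whole, although each of its entries is
  consistent with each \<open>E\<close>. Consider more generally persistence over a finite \<open>p\<close>, where the
  tuple only has to be inconsistent together with \<open>p\<close>, and choose \<open>n\<close> least such that this
  occurs for some \<open>p\<close>. Then \<open>n = m + 1\<close>, and by minimality persistence of length \<open>m\<close> fails over
  every \<open>E\<close>: near enough to \<open>A\<close>, any \<open>m\<close> entries are jointly consistent with \<open>E\<close>. So there are
  a set \<open>e\<close> of \<open>m\<close> entries and a single entry \<open>b\<close> such that \<open>p \<union> e \<union> {b}\<close> is inconsistent,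
  while \<open>e\<close> and \<open>b\<close> separately are consistent with every \<open>E\<close> of the family. Saturation upgrades
  this to consistency with all of \<open>A \<union> E\<close> at once (\<open>ex_separating_row\<close>), which is what allows the
  construction to be repeated.

  Iterating yields rows \<open>(e\<^sub>i, b\<^sub>i)\<close>, \<open>i < k\<close>, such that each of the \<open>2\<^sup>k\<close> ways to select \<open>e\<^sub>i\<close> or
  \<open>b\<^sub>i\<close> from every row is consistent with \<open>p\<close>. A realization of \<open>p\<close> and of a selection satisfies
  \<open>\<phi>(x; b\<^sub>i)\<close> exactly for those rows where \<open>b\<^sub>i\<close> is selected, since elsewhere it realizes
  \<open>p \<union> e\<^sub>i\<close>. So \<open>b\<^sub>0, \<dots>, b\<^sub>k\<^sub>-\<^sub>1\<close> is shattered, and \<open>\<phi>\<close> has the independence property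
  (\<open>has_IP_of_persistent_over\<close>).

  Saturation speaks about formulas, so consistency of finitely many instances of \<open>\<phi>\<close> has to be
  written as a formula first (\<open>ex_consistency_formula\<close>); saturation then becomes the compactness
  principle \<open>compactness\<close> for tuples of parameters, which is all that is used afterwards.
\<close>

section \<open>Renaming and quantifying variables\<close>

lemma tm_val_cong: "(\<And>v. v \<in> tm_vars t \<Longrightarrow> s v = s' v) \<Longrightarrow> tm_val M s t = tm_val M s' t"
proof (induction t)
  case (Fn f ts)
  then have "map (tm_val M s) ts = map (tm_val M s') ts" by auto
  then show ?case by (simp del: map_eq_conv)
qed simp

lemma sat_cong: "(\<And>v. v \<in> fv p \<Longrightarrow> s v = s' v) \<Longrightarrow> sat M s p = sat M s' p"
proof (induction p arbitrary: s s')
  case (Eq t u)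
  then show ?case using tm_val_cong[of t s s' M] tm_val_cong[of u s s' M] by simp
next
  case (Rel r ts)
  then have "map (tm_val M s) ts = map (tm_val M s') ts" by (auto intro!: tm_val_cong)
  then show ?case by (simp del: map_eq_conv)
next
  case (Neg p)
  then show ?case by (metis fv.simps(3) sat.simps(3))
next
  case (Conj p q)
  then show ?case by (metis UnCI fv.simps(4) sat.simps(4))
next
  case (Exists v p)
  have "sat M (s(v := m)) p = sat M (s'(v := m)) p" for m
    using Exists.prems by (intro Exists.IH) auto
  then show ?case by simp
qed

lemma tm_val_rename: "tm_val M s (tm_rename \<pi> t) = tm_val M (s \<circ> \<pi>) t"
proof (induction t)
  case (Fn f ts)
  then have "map (tm_val M s) (map (tm_rename \<pi>) ts) = map (tm_val M (s \<circ> \<pi>)) ts"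
    by (simp del: comp_apply) (simp add: comp_def)
  then show ?case by (simp only: tm_rename.simps tm_val.simps)
qed simp

lemma sat_rename:
  "inj \<pi> \<Longrightarrow> sat M s (rename \<pi> p) = sat M (s \<circ> \<pi>) p"
proof (induction p arbitrary: s)
  case (Rel r ts)
  have "map (tm_val M s) (map (tm_rename \<pi>) ts) = map (tm_val M (s \<circ> \<pi>)) ts"
    by (simp add: tm_val_rename)
  then show ?case by (simp only: rename.simps sat.simps)
next
  case (Exists v p)
  have "s(\<pi> v := m) \<circ> \<pi> = (s \<circ> \<pi>)(v := m)" for m
    using Exists.prems by (auto simp: fun_eq_iff inj_eq)
  then show ?case using Exists by (simp only: rename.simps sat.simps)
qed (simp_all add: tm_val_rename)

lemma tm_vars_rename: "tm_vars (tm_rename \<pi> t) = \<pi> ` tm_vars t"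
  by (induction t) auto

lemma fv_rename: "inj \<pi> \<Longrightarrow> fv (rename \<pi> p) = \<pi> ` fv p"
  by (induction p) (auto simp: tm_vars_rename inj_eq)

lemma tm_in_rename: "tm_in L (tm_rename \<pi> t) = tm_in L t"
  by (induction t) auto

lemma fm_in_rename: "fm_in L (rename \<pi> p) = fm_in L p"
  by (induction p) (auto simp: tm_in_rename)

text \<open>Instances of \<open>\<phi>\<close> are moved to prescribed variables by a renaming of all variables that has
  to be injective to avoid capture. Variables outside the list are shifted beyond every
  prescribed value.\<close>

lemma ex_inj_map_eq:
  fixes vs ws :: "nat list"
  assumes "distinct vs" "distinct ws" "length vs = length ws"
  shows "\<exists>\<pi>. inj \<pi> \<and> map \<pi> vs = ws"
proof -
  define \<pi> where "\<pi> v = (if v \<in> set vs then the (map_of (zip vs ws) v) else v + Suc (sum_list ws))"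
    for v
  have map: "map \<pi> vs = ws"
  proof (rule nth_equalityI)
    fix j assume "j < length (map \<pi> vs)"
    then show "map \<pi> vs ! j = ws ! j"
      using assms by (simp add: \<pi>_def map_of_zip_nth)
  qed (use assms in simp)
  have old: "\<pi> v \<in> set ws" if "v \<in> set vs" for v
    using map that by (metis image_eqI list.set_map)
  have new: "\<pi> v \<notin> set ws" if "v \<notin> set vs" for v
    using that member_le_sum_list[of "\<pi> v" ws] by (auto simp: \<pi>_def)
  have inj_vs: "inj_on \<pi> (set vs)"
    using assms(2) map distinct_map by blast
  have "inj \<pi>"
  proof (rule injI)
    fix u v assume eq: "\<pi> u = \<pi> v"
    consider "u \<in> set vs" "v \<in> set vs" | "u \<notin> set vs" "v \<notin> set vs"
      using old new eq by metis
    then show "u = v"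
      by cases (use eq inj_vs in \<open>auto simp: \<pi>_def inj_on_def\<close>)
  qed
  with map show ?thesis by blast
qed

definition Exists_block :: "nat \<Rightarrow> nat \<Rightarrow> ('f, 'r) fm \<Rightarrow> ('f, 'r) fm" where
  "Exists_block N l p = foldr Exists [N..<N + l] p"

lemma Exists_block_0: "Exists_block N 0 p = p"
  by (simp add: Exists_block_def)

lemma Exists_block_Suc: "Exists_block N (Suc l) p = Exists N (Exists_block (Suc N) l p)"
  by (simp add: Exists_block_def upt_rec[of N] del: upt_Suc)

lemma fv_Exists_block: "fv (Exists_block N l p) = fv p - {N..<N + l}"
  by (induction l arbitrary: N) (auto simp: Exists_block_0 Exists_block_Suc)

lemma fm_in_Exists_block: "fm_in L (Exists_block N l p) = fm_in L p"
  by (induction l arbitrary: N) (auto simp: Exists_block_0 Exists_block_Suc)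

lemma tuples_Suc: "a \<in> tuples U (Suc l) \<longleftrightarrow> (\<exists>m a'. a = m # a' \<and> m \<in> U \<and> a' \<in> tuples U l)"
  by (cases a) (auto simp: tuples_def)

lemma sat_Exists_block:
  "sat M s (Exists_block N l p) \<longleftrightarrow> (\<exists>a \<in> tuples (Univ M) l.
     sat M (\<lambda>v. if N \<le> v \<and> v < N + l then a ! (v - N) else s v) p)"
proof (induction l arbitrary: N s)
  case 0
  have "(\<lambda>v. if N \<le> v \<and> v < N + 0 then a ! (v - N) else s v) = s" for a
    by (rule ext) auto
  moreover have "tuples (Univ M) 0 = {[]}" by (auto simp: tuples_def)
  ultimately show ?case by (simp add: Exists_block_0)
next
  case (Suc l)
  have eq: "(\<lambda>v. if Suc N \<le> v \<and> v < Suc N + l then a ! (v - Suc N) else (s(N := m)) v) =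
      (\<lambda>v. if N \<le> v \<and> v < N + Suc l then (m # a) ! (v - N) else s v)" for m a
    by (auto simp: fun_eq_iff nth_Cons' less_Suc_eq_le)
  show ?case
    unfolding Exists_block_Suc sat.simps Suc.IH eq Bex_def tuples_Suc by blast
qed

text \<open>The last conjunct is a sentence valid in every nonempty structure, so that the empty
  conjunction has no free variables either.\<close>

definition Conjs :: "('f, 'r) fm list \<Rightarrow> ('f, 'r) fm" where
  "Conjs ps = foldr Conj ps (Exists 0 (Eq (Var 0) (Var 0)))"

lemma fv_Conjs: "fv (Conjs ps) = (\<Union>p \<in> set ps. fv p)"
  by (induction ps) (auto simp: Conjs_def)

lemma fm_in_Conjs: "fm_in L (Conjs ps) \<longleftrightarrow> (\<forall>p \<in> set ps. fm_in L p)"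
  by (induction ps) (auto simp: Conjs_def)

lemma sat_Conjs: "Univ M \<noteq> {} \<Longrightarrow> sat M s (Conjs ps) \<longleftrightarrow> (\<forall>p \<in> set ps. sat M s p)"
  by (induction ps) (auto simp: Conjs_def)


section \<open>Consistency is definable\<close>

definition consistent :: "('m, 'f, 'r) interp \<Rightarrow> ('f, 'r) pform \<Rightarrow> 'm list set \<Rightarrow> bool" where
  "consistent M \<phi> S \<longleftrightarrow> (\<exists>a \<in> xtuples M \<phi>. \<forall>z \<in> S. holds M \<phi> a z)"

lemma consistent_mono: "consistent M \<phi> S \<Longrightarrow> S' \<subseteq> S \<Longrightarrow> consistent M \<phi> S'"
  by (auto simp: consistent_def)

lemma char_seq_iff:
  "char_seq M \<phi> n zs \<longleftrightarrow> length zs = n \<and> set zs \<subseteq> ytuples M \<phi> \<and> consistent M \<phi> (set zs)"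
  by (simp add: char_seq_def consistent_def)

lemma nth_concat_uniform:
  "\<forall>y \<in> set ys. length y = m \<Longrightarrow> i < length ys \<Longrightarrow> t < m \<Longrightarrow> concat ys ! (i * m + t) = ys ! i ! t"
proof (induction ys arbitrary: i)
  case (Cons y ys)
  then show ?case by (cases i) (auto simp: nth_append add.assoc)
qed simp

lemma length_concat_uniform: "\<forall>y \<in> set ys. length y = m \<Longrightarrow> length (concat ys) = length ys * m"
  by (induction ys) auto

lemma ex_chunks: "d \<in> tuples U (n * m) \<Longrightarrow> \<exists>zs. length zs = n \<and> set zs \<subseteq> tuples U m \<and> concat zs = d"
proof (induction n arbitrary: d)
  case (Suc n)
  have "drop m d \<in> tuples U (n * m)" "take m d \<in> tuples U m"
    using Suc.prems by (auto simp: tuples_def dest: in_set_dropD in_set_takeD)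
  with Suc.IH[of "drop m d"] obtain zs
    where "length zs = n" "set zs \<subseteq> tuples U m" "concat zs = drop m d" by blast
  with \<open>take m d \<in> tuples U m\<close> show ?case by (intro exI[of _ "take m d # zs"]) auto
qed (auto simp: tuples_def)

text \<open>A list \<open>ys\<close> of \<open>r\<close> parameter tuples of length \<open>m\<close> is stored in the variables below \<open>r * m\<close>, one
  tuple after the other, and the realization \<open>a\<close> in the \<open>l\<close> variables from \<open>r * m\<close> on. This is the
  layout that a type with parameters uses, and it leaves the variables of \<open>a\<close> consecutive, ready
  to be quantified.\<close>

lemma ex_instance_formula:
  assumes pf: "is_pform L \<phi>" and i: "i < r"
  defines "m \<equiv> length (yvars \<phi>)" and "l \<equiv> length (xvars \<phi>)"
  shows "\<exists>p \<in> formulas L. fv p \<subseteq> {..<r * m + l} \<and>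
    (\<forall>ys a. length ys = r \<and> set ys \<subseteq> ytuples M \<phi> \<and> a \<in> xtuples M \<phi> \<longrightarrow>
      (sat M (\<lambda>v. if r * m \<le> v \<and> v < r * m + l then a ! (v - r * m) else concat ys ! v) p
        \<longleftrightarrow> holds M \<phi> a (ys ! i)))"
proof -
  define vs where "vs = xvars \<phi> @ yvars \<phi>"
  define ws where "ws = [r * m..<r * m + l] @ [i * m..<i * m + m]"
  have im: "i * m + m \<le> r * m"
    using i by (metis Suc_leI add.commute mult_Suc mult_le_mono1)
  have "distinct vs" "fv (body \<phi>) \<subseteq> set vs" "body \<phi> \<in> formulas L"
    using pf by (auto simp: is_pform_def vs_def)
  have lens: "length vs = l + m" "length ws = l + m"
    by (auto simp: vs_def ws_def m_def l_def)
  have "distinct ws" using im by (auto simp: ws_def)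
  obtain \<pi> where "inj \<pi>" and \<pi>: "map \<pi> vs = ws"
    using ex_inj_map_eq[OF \<open>distinct vs\<close> \<open>distinct ws\<close>] lens by auto
  have ws_bd: "set ws \<subseteq> {..<r * m + l}" using im by (auto simp: ws_def)
  show ?thesis
  proof (intro bexI[of _ "rename \<pi> (body \<phi>)"] conjI allI impI)
    show "rename \<pi> (body \<phi>) \<in> formulas L"
      using \<open>body \<phi> \<in> formulas L\<close> by (simp add: formulas_def fm_in_rename)
    have "\<pi> ` fv (body \<phi>) \<subseteq> set ws"
      using \<open>fv (body \<phi>) \<subseteq> set vs\<close> \<pi> by (metis image_mono list.set_map)
    then show "fv (rename \<pi> (body \<phi>)) \<subseteq> {..<r * m + l}"
      using ws_bd by (simp add: fv_rename[OF \<open>inj \<pi>\<close>])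
  next
    fix ys a
    assume ya: "length ys = r \<and> set ys \<subseteq> ytuples M \<phi> \<and> a \<in> xtuples M \<phi>"
    let ?s = "\<lambda>v. if r * m \<le> v \<and> v < r * m + l then a ! (v - r * m) else concat ys ! v"
    have ylen: "\<forall>y \<in> set ys. length y = m" and alen: "length a = l"
      using ya by (auto simp: ytuples_def xtuples_def tuples_def m_def l_def)
    have yi: "length (ys ! i) = m" using ylen ya i by simp
    have "(?s \<circ> \<pi>) v = the (map_of (zip vs (a @ ys ! i)) v)" if "v \<in> fv (body \<phi>)" for v
    proof -
      have "v \<in> set vs" using that \<open>fv (body \<phi>) \<subseteq> set vs\<close> by blast
      then obtain j where j: "j < l + m" "v = vs ! j"
        using lens(1) by (auto simp: in_set_conv_nth)
      have "\<pi> v = ws ! j" using j lens by (simp flip: \<pi>)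
      moreover have "?s (ws ! j) = (a @ ys ! i) ! j"
      proof (cases "j < l")
        case True
        then show ?thesis using alen by (simp add: ws_def nth_append)
      next
        case False
        then obtain t where t: "j = l + t" "t < m"
          using j by (intro that[of "j - l"]) auto
        then have "ws ! j = i * m + t" by (simp add: ws_def nth_append)
        moreover have "\<not> r * m \<le> i * m + t" using im t by linarith
        ultimately show ?thesis
          using t alen nth_concat_uniform[OF ylen, of i t] ya i by (simp add: nth_append)
      qed
      moreover have "map_of (zip vs (a @ ys ! i)) v = Some ((a @ ys ! i) ! j)"
        using j lens alen yi \<open>distinct vs\<close> by (simp add: map_of_zip_nth)
      ultimately show ?thesis by (simp only: comp_apply option.sel)
    qed
    then show "sat M ?s (rename \<pi> (body \<phi>)) \<longleftrightarrow> holds M \<phi> a (ys ! i)"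
      unfolding sat_rename[OF \<open>inj \<pi>\<close>] holds_def vs_def by (rule sat_cong)
  qed
qed

text \<open>Several instances of \<open>\<phi>\<close> share the variables of \<open>x\<close>, so a single block of quantifiers in front
  of their conjunction expresses that they have a common realization.\<close>

lemma ex_consistency_formula:
  assumes M: "is_structure L M" and pf: "is_pform L \<phi>"
    and I: "I \<subseteq> {..<r}"
  shows "\<exists>p \<in> formulas L. fv p \<subseteq> {..<r * length (yvars \<phi>)} \<and>
    (\<forall>ys. length ys = r \<and> set ys \<subseteq> ytuples M \<phi> \<longrightarrow>
      (sat M (\<lambda>v. concat ys ! v) p \<longleftrightarrow> consistent M \<phi> ((!) ys ` I)))"
proof -
  define m where "m = length (yvars \<phi>)"
  define l where "l = length (xvars \<phi>)"
  have "\<forall>i\<in>I. \<exists>p. p \<in> formulas L \<and> fv p \<subseteq> {..<r * m + l} \<and>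
    (\<forall>ys a. length ys = r \<and> set ys \<subseteq> ytuples M \<phi> \<and> a \<in> xtuples M \<phi> \<longrightarrow>
      (sat M (\<lambda>v. if r * m \<le> v \<and> v < r * m + l then a ! (v - r * m) else concat ys ! v) p
        \<longleftrightarrow> holds M \<phi> a (ys ! i)))"
    using ex_instance_formula[OF pf, where r = r and M = M, folded m_def l_def] I by blast
  from bchoice[OF this] obtain P where P: "\<forall>i \<in> I. P i \<in> formulas L"
    "\<forall>i \<in> I. fv (P i) \<subseteq> {..<r * m + l}"
    "\<And>i ys a. i \<in> I \<Longrightarrow> length ys = r \<Longrightarrow> set ys \<subseteq> ytuples M \<phi> \<Longrightarrow> a \<in> xtuples M \<phi> \<Longrightarrow>
      sat M (\<lambda>v. if r * m \<le> v \<and> v < r * m + l then a ! (v - r * m) else concat ys ! v) (P i)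
        \<longleftrightarrow> holds M \<phi> a (ys ! i)" by blast
  obtain js where js: "set js = I"
    using finite_list[OF finite_subset[OF I finite_lessThan]] by blast
  define p where "p = Exists_block (r * m) l (Conjs (map P js))"
  have "Univ M \<noteq> {}" using M by (simp add: is_structure_def)
  have "fv p \<subseteq> {..<r * m}"
  proof
    fix v assume "v \<in> fv p"
    then obtain i where i: "i \<in> I" "v \<in> fv (P i)" and "v \<notin> {r * m..<r * m + l}"
      using js by (auto simp: p_def fv_Exists_block fv_Conjs)
    moreover have "v < r * m + l" using P(2) i by blast
    ultimately show "v \<in> {..<r * m}" by simp
  qed
  moreover have "p \<in> formulas L"
    using P(1) js by (simp add: p_def formulas_def fm_in_Exists_block fm_in_Conjs)
  moreover have "sat M (\<lambda>v. concat ys ! v) p \<longleftrightarrow> consistent M \<phi> ((!) ys ` I)"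
    if "length ys = r" "set ys \<subseteq> ytuples M \<phi>" for ys
    using P(3)[OF _ that] js
    by (simp add: p_def sat_Exists_block sat_Conjs[OF \<open>Univ M \<noteq> {}\<close>] consistent_def
        xtuples_def l_def)
  ultimately show ?thesis unfolding m_def by blast
qed


section \<open>Compactness from saturation\<close>

text \<open>A cardinal above the number of formulas is therefore infinite, and finite sets of parameters
  are small.\<close>

lemma infinite_formulas: "infinite (formulas L)"
proof -
  have "(Neg ^^ k) (Eq (Var 0) (Var 0)) \<in> formulas L" for k
    by (induction k) (auto simp: formulas_def)
  moreover have "inj (\<lambda>k. (Neg ^^ k) (Eq (Var 0) (Var 0)))"
  proof (rule injI)
    fix i j :: nat
    assume "(Neg ^^ i) (Eq (Var 0) (Var 0)) = (Neg ^^ j) (Eq (Var 0) (Var 0))"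
    then show "i = j"
    proof (induction i arbitrary: j)
      case 0 then show ?case by (cases j) auto
    next
      case (Suc i) then show ?case by (cases j) auto
    qed
  qed
  ultimately show ?thesis
    by (metis finite_subset image_subsetI infinite_UNIV_nat finite_imageD)
qed

text \<open>A condition \<open>(s, I, E)\<close> on a tuple \<open>zs\<close> demands that its entries with index in \<open>I\<close> are consistent
  together with the parameters \<open>E\<close> if \<open>s\<close> is true, and that they are not if \<open>s\<close> is false.\<close>

definition meets ::
  "('m, 'f, 'r) interp \<Rightarrow> ('f, 'r) pform \<Rightarrow> 'm list list \<Rightarrow> bool \<times> nat set \<times> 'm list set \<Rightarrow> bool" where
  "meets M \<phi> zs = (\<lambda>(s, I, E). consistent M \<phi> ((!) zs ` I \<union> E) = s)"

text \<open>The parameters \<open>E\<close> are appended to the tuple, so that the condition is about the consistency of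
  a set of entries of the longer tuple.\<close>

lemma ex_condition_formula:
  assumes M: "is_structure L M" and pf: "is_pform L \<phi>"
    and I: "I \<subseteq> {..<n}" and E: "finite E" "E \<subseteq> D" "D \<subseteq> ytuples M \<phi>"
  shows "\<exists>p c. (p, c) \<in> param_formulas L (\<Union>(set ` D)) (n * length (yvars \<phi>)) \<and>
    (\<forall>zs. length zs = n \<and> set zs \<subseteq> ytuples M \<phi> \<longrightarrow>
      (sat M (\<lambda>v. (concat zs @ c) ! v) p \<longleftrightarrow> meets M \<phi> zs (s, I, E)))"
proof -
  define m where "m = length (yvars \<phi>)"
  obtain es where es: "set es = E" using finite_list[OF E(1)] by blast
  define r where "r = n + length es"
  define J where "J = I \<union> {n..<r}"
  have "J \<subseteq> {..<r}" using I by (auto simp: J_def r_def)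
  from ex_consistency_formula[OF M pf this] obtain p where p: "p \<in> formulas L" "fv p \<subseteq> {..<r * m}"
    "\<And>ys. length ys = r \<Longrightarrow> set ys \<subseteq> ytuples M \<phi> \<Longrightarrow>
      sat M (\<lambda>v. concat ys ! v) p \<longleftrightarrow> consistent M \<phi> ((!) ys ` J)"
    unfolding m_def by blast
  define p' where "p' = (if s then p else Neg p)"
  have "\<forall>e \<in> set es. length e = m" using es E by (auto simp: ytuples_def tuples_def m_def)
  from length_concat_uniform[OF this] have "r * m = n * m + length (concat es)"
    by (simp add: r_def algebra_simps)
  then have "(p', concat es) \<in> param_formulas L (\<Union>(set ` D)) (n * m)"
    using p E es by (auto simp: param_formulas_def p'_def formulas_def)
  moreover have "sat M (\<lambda>v. (concat zs @ concat es) ! v) p' \<longleftrightarrow> meets M \<phi> zs (s, I, E)"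
    if "length zs = n" "set zs \<subseteq> ytuples M \<phi>" for zs
  proof -
    have "{n..<r} = (+) n ` {..<length es}"
      by (simp add: r_def add.commute flip: atLeast0LessThan)
    then have "(!) (zs @ es) ` {n..<r} = (\<lambda>i. (zs @ es) ! (length zs + i)) ` {..<length es}"
      using that(1) by (simp only: image_image)
    also have "\<dots> = (!) es ` {..<length es}"
      by (simp only: nth_append_length_plus)
    also have "\<dots> = E"
      unfolding es[symmetric] by (rule nth_image[of "length es" es, simplified, unfolded atLeast0LessThan])
    finally have "(!) (zs @ es) ` {n..<r} = E" .
    moreover have "(!) (zs @ es) ` I = (!) zs ` I"
    proof (rule image_cong[OF refl])
      fix i assume "i \<in> I"
      then have "i < length zs" using I that(1) by blast
      then show "(zs @ es) ! i = zs ! i" by (rule nth_append_left)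
    qed
    ultimately have "(!) (zs @ es) ` J = (!) zs ` I \<union> E" by (simp add: J_def image_Un)
    moreover have "sat M (\<lambda>v. concat (zs @ es) ! v) p \<longleftrightarrow> consistent M \<phi> ((!) (zs @ es) ` J)"
      using that es E by (intro p(3)) (auto simp: r_def)
    ultimately show ?thesis by (simp add: p'_def meets_def)
  qed
  ultimately show ?thesis unfolding m_def by blast
qed

lemma finite_card_of_less:
  assumes "finite X" "Card_order r" "infinite (Field r)"
  shows "(card_of X, r) \<in> ordLess"
proof -
  have "Well_order r" using assms(2) card_order_on_well_order_on by blast
  then show ?thesis
    using finite_ordLess_infinite[OF card_of_Well_order] assms by (simp add: Field_card_of)
qed

lemma infinite_Field_of_large:
  assumes "Card_order \<kappa>" "(card_of (formulas L), \<kappa>) \<in> ordLess"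
  shows "infinite (Field \<kappa>)"
  using card_of_ordLeq_finite[OF ordLess_imp_ordLeq[OF ordLess_ordIso_trans[OF assms(2)
    ordIso_symmetric[OF card_of_Field_ordIso[OF assms(1)]]]]] infinite_formulas by blast

text \<open>The conditions translate into a type whose parameters are the coordinates of the elements of
  \<open>D\<close>. There are fewer than \<open>\<kappa>\<close> of them: finitely many if \<open>D\<close> is finite, and otherwise no more than
  there are elements of \<open>D\<close>.\<close>

lemma compactness:
  fixes D :: "'m list set"
  assumes M: "is_structure L M" and pf: "is_pform L \<phi>"
    and \<kappa>: "Card_order \<kappa>" "(card_of (formulas L), \<kappa>) \<in> ordLess" "saturated L \<kappa> M"
    and D: "D \<subseteq> ytuples M \<phi>" "(card_of D, \<kappa>) \<in> ordLess"
    and Q: "\<And>s I E. (s, I, E) \<in> Q \<Longrightarrow> I \<subseteq> {..<n} \<and> finite E \<and> E \<subseteq> D"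
    and fin: "\<And>Q0. finite Q0 \<Longrightarrow> Q0 \<subseteq> Q \<Longrightarrow>
      \<exists>zs. length zs = n \<and> set zs \<subseteq> ytuples M \<phi> \<and> (\<forall>q \<in> Q0. meets M \<phi> zs q)"
  shows "\<exists>zs. length zs = n \<and> set zs \<subseteq> ytuples M \<phi> \<and> (\<forall>q \<in> Q. meets M \<phi> zs q)"
proof -
  define m where "m = length (yvars \<phi>)"
  define C where "C = \<Union>(set ` D)"
  have inf: "infinite (Field \<kappa>)" by (rule infinite_Field_of_large[OF \<kappa>(1,2)])
  have C_small: "(card_of C, \<kappa>) \<in> ordLess"
  proof (cases "finite D")
    case True
    then show ?thesis using finite_card_of_less[OF _ \<kappa>(1) inf, of C] by (simp add: C_def)
  next
    case False
    have "(card_of (set d), card_of D) \<in> ordLeq" for d :: "'m list"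
      using ordLess_imp_ordLeq[OF finite_card_of_less[OF finite_set card_of_Card_order]] False
      by (simp add: Field_card_of)
    then have "(card_of C, card_of D) \<in> ordLeq"
      unfolding C_def
      by (intro card_of_UNION_ordLeq_infinite[OF False ordLeq_refl[OF card_of_Card_order]]) blast
    then show ?thesis using D(2) ordLeq_ordLess_trans by blast
  qed
  have C_Univ: "C \<subseteq> Univ M"
    using D(1) unfolding C_def ytuples_def tuples_def by blast
  have "\<forall>q\<in>Q. \<exists>pc. pc \<in> param_formulas L C (n * m) \<and>
    (\<forall>zs. length zs = n \<and> set zs \<subseteq> ytuples M \<phi> \<longrightarrow>
      (realizes M (concat zs) {pc} \<longleftrightarrow> meets M \<phi> zs q))"
  proof
    fix q assume "q \<in> Q"
    obtain s I E where q: "q = (s, I, E)" by (cases q)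
    with \<open>q \<in> Q\<close> Q have "I \<subseteq> {..<n}" "finite E" "E \<subseteq> D" by auto
    from ex_condition_formula[OF M pf this D(1), of s] obtain p c
      where pc: "(p, c) \<in> param_formulas L C (n * m)"
      "\<forall>zs. length zs = n \<and> set zs \<subseteq> ytuples M \<phi> \<longrightarrow>
        (sat M (\<lambda>v. (concat zs @ c) ! v) p \<longleftrightarrow> meets M \<phi> zs q)"
      unfolding q C_def m_def by blast
    then show "\<exists>pc. pc \<in> param_formulas L C (n * m) \<and>
      (\<forall>zs. length zs = n \<and> set zs \<subseteq> ytuples M \<phi> \<longrightarrow>
        (realizes M (concat zs) {pc} \<longleftrightarrow> meets M \<phi> zs q))"
      by (intro exI[of _ "(p, c)"]) (simp add: realizes_def)
  qed
  from bchoice[OF this] obtain f where f: "\<And>q. q \<in> Q \<Longrightarrow> f q \<in> param_formulas L C (n * m)"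
    "\<And>q zs. q \<in> Q \<Longrightarrow> length zs = n \<Longrightarrow> set zs \<subseteq> ytuples M \<phi> \<Longrightarrow>
      realizes M (concat zs) {f q} \<longleftrightarrow> meets M \<phi> zs q" by blast
  have realizes_image: "realizes M (concat zs) (f ` Q0) \<longleftrightarrow> (\<forall>q \<in> Q0. meets M \<phi> zs q)"
    if "Q0 \<subseteq> Q" "length zs = n" "set zs \<subseteq> ytuples M \<phi>" for Q0 zs
  proof -
    have "realizes M (concat zs) (f ` Q0) \<longleftrightarrow> (\<forall>q \<in> Q0. realizes M (concat zs) {f q})"
      by (auto simp: realizes_def)
    then show ?thesis using f(2) that by blast
  qed
  have fin_real: "\<exists>d \<in> tuples (Univ M) (n * m). realizes M d q0" if q0: "finite q0" "q0 \<subseteq> f ` Q" for q0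
  proof -
    obtain Q0 where Q0: "Q0 \<subseteq> Q" "finite Q0" "q0 = f ` Q0"
      using finite_subset_image[OF q0] by blast
    from fin[OF Q0(2,1)] obtain zs where zs: "length zs = n" "set zs \<subseteq> ytuples M \<phi>"
      "\<forall>q \<in> Q0. meets M \<phi> zs q" by blast
    have "\<forall>z \<in> set zs. length z = m" using zs by (auto simp: ytuples_def tuples_def m_def)
    then have "concat zs \<in> tuples (Univ M) (n * m)"
      using zs(1,2) length_concat_uniform[of zs m] unfolding tuples_def ytuples_def by auto
    then show ?thesis using realizes_image[OF Q0(1) zs(1,2)] zs(3) Q0(3) by blast
  qed
  have "f ` Q \<subseteq> param_formulas L C (n * m)" using f(1) by blast
  then have "\<exists>d \<in> tuples (Univ M) (n * m). realizes M d (f ` Q)"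
    using C_Univ C_small fin_real
    by (intro \<kappa>(3)[unfolded saturated_def, rule_format, of C]) simp
  then obtain d where d: "d \<in> tuples (Univ M) (n * m)" "realizes M d (f ` Q)" by blast
  from ex_chunks[OF d(1)] obtain zs where zs: "length zs = n" "set zs \<subseteq> ytuples M \<phi>" "concat zs = d"
    unfolding ytuples_def m_def by blast
  have "\<forall>q \<in> Q. meets M \<phi> zs q"
    using realizes_image[OF subset_refl zs(1,2)] d(2) unfolding zs(3) by blast
  then show ?thesis using zs(1,2) by blast
qed


section \<open>Producing the independence property\<close>

definition fin_consistent :: "('m, 'f, 'r) interp \<Rightarrow> ('f, 'r) pform \<Rightarrow> 'm list set \<Rightarrow> bool" where
  "fin_consistent M \<phi> S \<longleftrightarrow> (\<forall>S0. finite S0 \<and> S0 \<subseteq> S \<longrightarrow> consistent M \<phi> S0)"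

text \<open>These are the admissible parameter sets of localizations: \<open>P\<^sub>r(y, E)\<close> holds on \<open>A\<close> because each
  \<open>a \<in> A\<close> is consistent with \<open>E\<close>.\<close>

definition extenders :: "('m, 'f, 'r) interp \<Rightarrow> ('f, 'r) pform \<Rightarrow> 'm list set \<Rightarrow> 'm list set set" where
  "extenders M \<phi> A = {E. finite E \<and> E \<subseteq> ytuples M \<phi> \<and> fin_consistent M \<phi> (A \<union> E)}"

text \<open>The solution set of the conjunction of the formulas \<open>P\<^sub>r(y, E)\<close>.\<close>

definition neighbours ::
  "('m, 'f, 'r) interp \<Rightarrow> ('f, 'r) pform \<Rightarrow> 'm list set set \<Rightarrow> 'm list set" where
  "neighbours M \<phi> \<E> = {y \<in> ytuples M \<phi>. \<forall>E \<in> \<E>. consistent M \<phi> (insert y E)}"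

text \<open>For \<open>p = {}\<close> this is a consequence of persistence of empty tuples around a nonempty positive
  base set, seen only through localizations in which \<open>y\<close> occurs in every conjunct. The extra set \<open>p\<close> makes the notion stable enough for an argument by
  a least \<open>n\<close>: its failure at a smaller length can be used over any other parameter set.\<close>

definition persistent_over ::
  "('m, 'f, 'r) interp \<Rightarrow> ('f, 'r) pform \<Rightarrow> 'm list set \<Rightarrow> nat \<Rightarrow> 'm list set \<Rightarrow> bool" where
  "persistent_over M \<phi> A n p \<longleftrightarrow> p \<in> extenders M \<phi> A \<and>
     (\<forall>\<E>. finite \<E> \<and> \<E> \<subseteq> extenders M \<phi> A \<longrightarrow>
       (\<exists>zs. length zs = n \<and> set zs \<subseteq> neighbours M \<phi> \<E> \<and> \<not> consistent M \<phi> (p \<union> set zs)))"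

lemma persistent_overD:
  assumes "persistent_over M \<phi> A n p" "finite \<E>" "\<E> \<subseteq> extenders M \<phi> A"
  shows "\<exists>zs. length zs = n \<and> set zs \<subseteq> neighbours M \<phi> \<E> \<and> \<not> consistent M \<phi> (p \<union> set zs)"
  using assms by (simp add: persistent_over_def)

lemma not_persistent_overD:
  assumes "\<not> persistent_over M \<phi> A n p" "p \<in> extenders M \<phi> A"
  shows "\<exists>\<F>. finite \<F> \<and> \<F> \<subseteq> extenders M \<phi> A \<and>
    (\<forall>zs. length zs = n \<and> set zs \<subseteq> neighbours M \<phi> \<F> \<longrightarrow> consistent M \<phi> (p \<union> set zs))"
  using assms by (simp add: persistent_over_def) blast

lemma not_persistent_over_0: "\<not> persistent_over M \<phi> A 0 p"
proof
  assume pers: "persistent_over M \<phi> A 0 p"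
  then have "consistent M \<phi> p"
    by (auto simp: persistent_over_def extenders_def fin_consistent_def)
  moreover have "\<not> consistent M \<phi> p"
    using persistent_overD[OF pers, of "{}"] by simp
  ultimately show False by blast
qed

text \<open>The conditions sought are: the first \<open>m\<close> entries are consistent with each finite part of
  \<open>A \<union> p \<union> P\<close>, so is the last one, and all entries together are inconsistent with \<open>p\<close>. Finitely many
  of them involve only finitely many sets \<open>E\<close>. For each of these, the failure of persistence of
  length \<open>m\<close> over \<open>E\<close> gives a finite family near which all \<open>m\<close>-tuples are consistent with \<open>E\<close>;
  persistence over \<open>p\<close>, applied to the union of these families and the sets \<open>E\<close> themselves, gives a
  tuple as required. Compactness does the rest.\<close>

lemma ex_separating_row:
  assumes M: "is_structure L M" and pf: "is_pform L \<phi>"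
    and \<kappa>: "Card_order \<kappa>" "(card_of (formulas L), \<kappa>) \<in> ordLess" "saturated L \<kappa> M"
    and A: "A \<subseteq> ytuples M \<phi>" "(card_of A, \<kappa>) \<in> ordLess"
    and pers: "persistent_over M \<phi> A (Suc m) p"
    and least: "\<And>p'. \<not> persistent_over M \<phi> A m p'"
    and \<P>: "finite \<P>" "\<And>P. P \<in> \<P> \<Longrightarrow> p \<union> P \<in> extenders M \<phi> A"
  shows "\<exists>e b. \<not> consistent M \<phi> (p \<union> insert b e) \<and>
    (\<forall>P \<in> \<P>. p \<union> (P \<union> e) \<in> extenders M \<phi> A \<and> p \<union> insert b P \<in> extenders M \<phi> A)"
proof -
  define D where "D = A \<union> p \<union> \<Union>\<P>"
  define \<E> where "\<E> = {A0 \<union> p \<union> P |A0 P. finite A0 \<and> A0 \<subseteq> A \<and> P \<in> \<P>}"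
  define Q where "Q = insert (False, {..<Suc m}, p)
    ((\<lambda>E. (True, {..<m}, E)) ` \<E> \<union> (\<lambda>E. (True, {m}, E)) ` \<E>)"
  have p: "p \<in> extenders M \<phi> A" "finite p" "p \<subseteq> ytuples M \<phi>"
    using pers by (auto simp: persistent_over_def extenders_def)
  have P: "finite P" "P \<subseteq> ytuples M \<phi>" if "P \<in> \<P>" for P
    using \<P>(2)[OF that] by (auto simp: extenders_def)
  have \<E>_ext: "\<E> \<subseteq> extenders M \<phi> A"
  proof
    fix E assume "E \<in> \<E>"
    then obtain A0 P where E: "E = A0 \<union> p \<union> P" "finite A0" "A0 \<subseteq> A" "P \<in> \<P>"
      by (auto simp: \<E>_def)
    then have "A \<union> E = A \<union> (p \<union> P)" by blast
    then show "E \<in> extenders M \<phi> A"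
      using \<P>(2)[OF E(4)] E A(1) by (auto simp: extenders_def)
  qed
  have inf: "infinite (Field \<kappa>)" by (rule infinite_Field_of_large[OF \<kappa>(1,2)])
  have "finite (p \<union> \<Union>\<P>)" using p(2) P \<P>(1) by simp
  from card_of_Un_ordLess_infinite_Field[OF inf \<kappa>(1) A(2) finite_card_of_less[OF this \<kappa>(1) inf]]
  have D_small: "(card_of D, \<kappa>) \<in> ordLess" by (simp add: D_def Un_assoc)
  have D: "D \<subseteq> ytuples M \<phi>" using A(1) p(3) P(2) unfolding D_def by blast
  have Q: "I \<subseteq> {..<Suc m} \<and> finite E \<and> E \<subseteq> D" if sIE: "(s, I, E) \<in> Q" for s I E
  proof -
    have in_D: "finite E \<and> E \<subseteq> D" if "E \<in> \<E>" for E
    proof -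
      from that obtain A0 P where E: "E = A0 \<union> p \<union> P" "finite A0" "A0 \<subseteq> A" "P \<in> \<P>"
        by (auto simp: \<E>_def)
      have "finite P" "P \<subseteq> \<Union>\<P>" using P(1)[OF E(4)] E(4) by auto
      then show ?thesis using E p(2) unfolding D_def by blast
    qed
    have "I \<subseteq> {..<Suc m} \<and> (E = p \<or> E \<in> \<E>)" using sIE by (auto simp: Q_def)
    moreover have "finite p \<and> p \<subseteq> D" using p(2) by (auto simp: D_def)
    ultimately show ?thesis using in_D by blast
  qed
  have fin_sat: "\<exists>zs. length zs = Suc m \<and> set zs \<subseteq> ytuples M \<phi> \<and> (\<forall>q \<in> Q0. meets M \<phi> zs q)"
    if Q0: "finite Q0" "Q0 \<subseteq> Q" for Q0
  proof -
    define \<E>0 where "\<E>0 = \<E> \<inter> (snd \<circ> snd) ` Q0"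
    have "finite \<E>0" using Q0(1) by (simp add: \<E>0_def)
    have \<E>0_ext: "\<E>0 \<subseteq> extenders M \<phi> A" using \<E>_ext by (auto simp: \<E>0_def)
    let ?bounds = "\<lambda>E \<F>. finite \<F> \<and> \<F> \<subseteq> extenders M \<phi> A \<and>
      (\<forall>zs. length zs = m \<and> set zs \<subseteq> neighbours M \<phi> \<F> \<longrightarrow> consistent M \<phi> (E \<union> set zs))"
    have "\<forall>E\<in>\<E>0. \<exists>\<F>. ?bounds E \<F>"
      by (intro ballI not_persistent_overD[OF least]) (use \<E>0_ext in blast)
    from bchoice[OF this] obtain \<F> where "\<forall>E\<in>\<E>0. ?bounds E (\<F> E)" ..
    then have \<F>: "\<And>E. E \<in> \<E>0 \<Longrightarrow> finite (\<F> E)"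
      "\<And>E. E \<in> \<E>0 \<Longrightarrow> \<F> E \<subseteq> extenders M \<phi> A"
      "\<And>E zs. E \<in> \<E>0 \<Longrightarrow> length zs = m \<Longrightarrow> set zs \<subseteq> neighbours M \<phi> (\<F> E) \<Longrightarrow>
        consistent M \<phi> (E \<union> set zs)" by simp_all
    \<comment> \<open>The families \<open>\<F> E\<close> control the first \<open>m\<close> entries, the sets \<open>E\<close> the last one.\<close>
    define \<G> where "\<G> = \<E>0 \<union> (\<Union>E\<in>\<E>0. \<F> E)"
    have "finite \<G>" "\<G> \<subseteq> extenders M \<phi> A"
      using \<open>finite \<E>0\<close> \<E>0_ext \<F>(1,2) unfolding \<G>_def by (simp_all add: UN_subset_iff)
    from persistent_overD[OF pers this] obtain zs where zs: "length zs = Suc m" "set zs \<subseteq> neighbours M \<phi> \<G>"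
      "\<not> consistent M \<phi> (p \<union> set zs)" by blast
    have img: "(!) zs ` {..<Suc m} = set zs" "(!) zs ` {..<m} = set (take m zs)"
      using zs(1) nth_image[of "Suc m" zs] nth_image[of m zs] by (simp_all add: atLeast0LessThan)
    have "meets M \<phi> zs (True, {..<m}, E) \<and> meets M \<phi> zs (True, {m}, E)" if "E \<in> \<E>0" for E
    proof
      have "neighbours M \<phi> \<G> \<subseteq> neighbours M \<phi> (\<F> E)"
        using that by (auto simp: neighbours_def \<G>_def)
      then have "consistent M \<phi> (E \<union> set (take m zs))"
        using zs set_take_subset[of m zs] by (intro \<F>(3)[OF that]) auto
      then show "meets M \<phi> zs (True, {..<m}, E)"
        unfolding meets_def by (simp add: img Un_commute)
      have "zs ! m \<in> set zs" using zs(1) by simp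
      then have "consistent M \<phi> (insert (zs ! m) E)"
        using zs(2) that by (auto simp: neighbours_def \<G>_def)
      then show "meets M \<phi> zs (True, {m}, E)" by (simp add: meets_def)
    qed
    moreover have "meets M \<phi> zs (False, {..<Suc m}, p)"
      using zs(3) unfolding meets_def by (simp add: img Un_commute)
    ultimately have "\<forall>q \<in> Q0. meets M \<phi> zs q"
    proof (intro ballI)
      fix q assume rows: "\<And>E. E \<in> \<E>0 \<Longrightarrow>
          meets M \<phi> zs (True, {..<m}, E) \<and> meets M \<phi> zs (True, {m}, E)"
        and base: "meets M \<phi> zs (False, {..<Suc m}, p)" and q: "q \<in> Q0"
      have "snd (snd q) \<in> \<E>0" if "snd (snd q) \<in> \<E>" using q that by (auto simp: \<E>0_def)
      moreover have "q \<in> Q" using q Q0(2) by blast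
      ultimately show "meets M \<phi> zs q" using rows base unfolding Q_def by auto
    qed
    moreover have "set zs \<subseteq> ytuples M \<phi>" using zs(2) by (auto simp: neighbours_def)
    ultimately show ?thesis using zs(1) by blast
  qed
  have "\<exists>zs. length zs = Suc m \<and> set zs \<subseteq> ytuples M \<phi> \<and> (\<forall>q \<in> Q. meets M \<phi> zs q)"
    by (rule compactness[OF M pf \<kappa> D D_small]) (erule Q, erule (1) fin_sat)
  then obtain zs
    where zs: "length zs = Suc m" "set zs \<subseteq> ytuples M \<phi>" "\<forall>q \<in> Q. meets M \<phi> zs q" by blast
  define e where "e = (!) zs ` {..<m}"
  define b where "b = zs ! m"
  have e: "finite e" "e \<subseteq> ytuples M \<phi>" and b: "b \<in> ytuples M \<phi>"
    using zs by (auto simp: e_def b_def)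
  have "(!) zs ` {..<Suc m} = insert b e" by (simp add: e_def b_def lessThan_Suc)
  moreover have "meets M \<phi> zs (False, {..<Suc m}, p)" using zs(3) by (simp add: Q_def)
  ultimately have "\<not> consistent M \<phi> (p \<union> insert b e)" by (simp add: meets_def Un_commute)
  moreover have "\<forall>P \<in> \<P>. p \<union> (P \<union> e) \<in> extenders M \<phi> A \<and> p \<union> insert b P \<in> extenders M \<phi> A"
  proof
    fix P assume "P \<in> \<P>"
    have fin: "fin_consistent M \<phi> (A \<union> (p \<union> P) \<union> e')"
      if e': "\<And>E. E \<in> \<E> \<Longrightarrow> consistent M \<phi> (E \<union> e')" for e'
      unfolding fin_consistent_def
    proof (intro allI impI, elim conjE)
      fix S assume S: "finite S" "S \<subseteq> A \<union> (p \<union> P) \<union> e'"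
      \<comment> \<open>Only the part of \<open>S\<close> in \<open>A\<close> has to be cut down to a finite set.\<close>
      have "S \<inter> A \<union> p \<union> P \<in> \<E>" using S(1) \<open>P \<in> \<P>\<close> unfolding \<E>_def by blast
      from consistent_mono[OF e'[OF this]] show "consistent M \<phi> S" using S(2) by blast
    qed
    have "consistent M \<phi> (E \<union> e)" "consistent M \<phi> (E \<union> {b})" if "E \<in> \<E>" for E
    proof -
      have "meets M \<phi> zs (True, {..<m}, E)" "meets M \<phi> zs (True, {m}, E)"
        using zs(3) that by (auto simp: Q_def)
      then show "consistent M \<phi> (E \<union> e)" "consistent M \<phi> (E \<union> {b})"
        by (simp_all add: meets_def e_def b_def Un_commute)
    qed
    then have "fin_consistent M \<phi> (A \<union> (p \<union> P) \<union> e)" "fin_consistent M \<phi> (A \<union> (p \<union> P) \<union> {b})"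
      by (blast intro: fin)+
    moreover have "A \<union> (p \<union> P) \<union> e = A \<union> (p \<union> (P \<union> e))"
      "A \<union> (p \<union> P) \<union> {b} = A \<union> (p \<union> insert b P)" by blast+
    ultimately show "p \<union> (P \<union> e) \<in> extenders M \<phi> A \<and> p \<union> insert b P \<in> extenders M \<phi> A"
      using e b p(2,3) P[OF \<open>P \<in> \<P>\<close>] unfolding extenders_def by simp
  qed
  ultimately show ?thesis by (intro exI[of _ e] exI[of _ b] conjI)
qed

text \<open>Separating rows are added one at a time, each consistent with all selections from the rows
  before it. The least \<open>n\<close> is fixed before the induction, and the same \<open>p\<close> serves for all rows.\<close>

lemma has_IP_of_persistent_over:
  fixes M :: "('m, 'f, 'r) interp"
  assumes M: "is_structure L M" and pf: "is_pform L \<phi>"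
    and \<kappa>: "Card_order \<kappa>" "(card_of (formulas L), \<kappa>) \<in> ordLess" "saturated L \<kappa> M"
    and A: "A \<subseteq> ytuples M \<phi>" "(card_of A, \<kappa>) \<in> ordLess"
    and pers: "persistent_over M \<phi> A n p\<^sub>0"
  shows "has_IP M \<phi>"
proof -
  define N where "N = (LEAST n. \<exists>p. persistent_over M \<phi> A n p)"
  have "\<exists>p. persistent_over M \<phi> A N p"
    unfolding N_def by (rule LeastI_ex) (use pers in blast)
  then obtain p where p: "persistent_over M \<phi> A N p" by blast
  then obtain m where m: "N = Suc m" using not_persistent_over_0 by (cases N) auto
  have least: "\<not> persistent_over M \<phi> A m p'" for p'
    using not_less_Least[of m "\<lambda>n. \<exists>p. persistent_over M \<phi> A n p"] m unfolding N_def by auto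
  \<comment> \<open>The selection that takes \<open>b i\<close> from the rows in \<open>S\<close> and \<open>e i\<close> from the others.\<close>
  define path where "path b e k S = b ` S \<union> (\<Union>i \<in> {..<k} - S. e i)"
    for b :: "nat \<Rightarrow> 'm list" and e :: "nat \<Rightarrow> 'm list set" and k S
  have rows: "\<exists>b e. (\<forall>i<k. \<not> consistent M \<phi> (p \<union> insert (b i) (e i))) \<and>
    (\<forall>S \<subseteq> {..<k}. p \<union> path b e k S \<in> extenders M \<phi> A)" for k
  proof (induction k)
    case 0
    then show ?case using p by (simp add: path_def persistent_over_def)
  next
    case (Suc k)
    then obtain b e where be: "\<forall>i<k. \<not> consistent M \<phi> (p \<union> insert (b i) (e i))"
      "\<forall>S \<subseteq> {..<k}. p \<union> path b e k S \<in> extenders M \<phi> A" by blast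
    have "finite (path b e k ` Pow {..<k})" by simp
    have "\<exists>e' b'. \<not> consistent M \<phi> (p \<union> insert b' e') \<and>
      (\<forall>P \<in> path b e k ` Pow {..<k}.
        p \<union> (P \<union> e') \<in> extenders M \<phi> A \<and> p \<union> insert b' P \<in> extenders M \<phi> A)"
      by (rule ex_separating_row[OF M pf \<kappa> A p[unfolded m] least \<open>finite _\<close>]) (use be(2) in blast)
    then obtain e' b' where row0: "\<not> consistent M \<phi> (p \<union> insert b' e')"
      "\<forall>P \<in> path b e k ` Pow {..<k}.
        p \<union> (P \<union> e') \<in> extenders M \<phi> A \<and> p \<union> insert b' P \<in> extenders M \<phi> A" by blast
    have row: "p \<union> (path b e k S \<union> e') \<in> extenders M \<phi> A"
      "p \<union> insert b' (path b e k S) \<in> extenders M \<phi> A" if "S \<subseteq> {..<k}" for S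
      using bspec[OF row0(2) imageI, of S] that by simp_all
    have ext: "p \<union> path (b(k := b')) (e(k := e')) (Suc k) S \<in> extenders M \<phi> A"
      if S: "S \<subseteq> {..<Suc k}" for S
    proof (cases "k \<in> S")
      case True
      define S' where "S' = S - {k}"
      have S': "S = insert k S'" "S' \<subseteq> {..<k}" "k \<notin> S'"
        using True S by (auto simp: S'_def less_Suc_eq)
      have "{..<Suc k} - S = {..<k} - S'" unfolding S'(1) by auto
      moreover have "(\<Union>i \<in> {..<k} - S'. (e(k := e')) i) = (\<Union>i \<in> {..<k} - S'. e i)" by simp
      moreover have "(b(k := b')) ` S = insert b' (b ` S')"
        unfolding S'(1) using S'(3) by auto
      ultimately have "path (b(k := b')) (e(k := e')) (Suc k) S = insert b' (path b e k S')"
        by (simp add: path_def)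
      then show ?thesis using row(2)[OF S'(2)] by simp
    next
      case False
      then have Sk: "S \<subseteq> {..<k}" using S by (auto simp: less_Suc_eq)
      have "{..<Suc k} - S = insert k ({..<k} - S)" using False by auto
      moreover have "(\<Union>i \<in> {..<k} - S. (e(k := e')) i) = (\<Union>i \<in> {..<k} - S. e i)" by simp
      moreover have "(b(k := b')) ` S = b ` S" using False by auto
      ultimately have "path (b(k := b')) (e(k := e')) (Suc k) S = path b e k S \<union> e'"
        by (auto simp: path_def)
      then show ?thesis using row(1)[OF Sk] by simp
    qed
    have sep: "\<forall>i<Suc k. \<not> consistent M \<phi> (p \<union> insert ((b(k := b')) i) ((e(k := e')) i))"
      using be(1) row0(1) by (auto simp: less_Suc_eq)
    show ?case
      by (intro exI[of _ "b(k := b')"] exI[of _ "e(k := e')"] conjI allI impI sep ext)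
  qed
  show ?thesis
    unfolding has_IP_def
  proof
    fix k
    from rows[of k] obtain b e where be: "\<forall>i<k. \<not> consistent M \<phi> (p \<union> insert (b i) (e i))"
      "\<And>S. S \<subseteq> {..<k} \<Longrightarrow> p \<union> path b e k S \<in> extenders M \<phi> A" by blast
    have "b i \<in> ytuples M \<phi>" if "i < k" for i
      using be(2)[of "{..<k}"] that by (auto simp: extenders_def path_def)
    moreover have "\<exists>a \<in> xtuples M \<phi>. \<forall>i<k. holds M \<phi> a (b i) \<longleftrightarrow> i \<in> S" if S: "S \<subseteq> {..<k}" for S
    proof -
      have "consistent M \<phi> (p \<union> path b e k S)"
        using be(2)[OF S] unfolding extenders_def fin_consistent_def by blast
      then obtain a where a: "a \<in> xtuples M \<phi>" "\<forall>z \<in> p \<union> path b e k S. holds M \<phi> a z"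
        unfolding consistent_def by blast
      have "holds M \<phi> a (b i) \<longleftrightarrow> i \<in> S" if "i < k" for i
      proof
        assume "i \<in> S"
        then show "holds M \<phi> a (b i)" using a(2) by (simp add: path_def)
      next
        assume b: "holds M \<phi> a (b i)"
        show "i \<in> S"
        proof (rule ccontr)
          assume "i \<notin> S"
          then have "e i \<subseteq> path b e k S" using that by (auto simp: path_def)
          then have "consistent M \<phi> (p \<union> insert (b i) (e i))"
            using a b unfolding consistent_def by blast
          then show False using be(1) that by blast
        qed
      qed
      with a(1) show ?thesis by blast
    qed
    ultimately show "\<exists>b. (\<forall>i<k. b i \<in> ytuples M \<phi>) \<and>
       (\<forall>S \<subseteq> {..<k}. \<exists>a \<in> xtuples M \<phi>. \<forall>i<k. holds M \<phi> a (b i) \<longleftrightarrow> i \<in> S)" by blast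
  qed
qed


section \<open>Localizations\<close>

lemma fin_consistent_base: "positive_base_set M \<phi> A \<Longrightarrow> fin_consistent M \<phi> A"
  unfolding positive_base_set_def complete_graph_def fin_consistent_def char_seq_iff
  by (metis finite_list)

text \<open>One conjunct \<open>P\<^sub>r(y, E)\<close> for each \<open>E\<close> in the family. As the localization contains the nonempty
  positive base set \<open>A\<close>, that set also witnesses nontriviality, for every \<open>\<ell>\<close>.\<close>

lemma ex_localization:
  assumes base: "positive_base_set M \<phi> A" "A \<noteq> {}"
    and \<E>: "finite \<E>" "\<E> \<subseteq> extenders M \<phi> A"
  shows "\<exists>B F. finite B \<and> B \<subseteq> Univ M \<and> is_localization M \<phi> A B F \<and>
    loc_set M \<phi> F \<subseteq> neighbours M \<phi> \<E>"
proof -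
  have AY: "A \<subseteq> ytuples M \<phi>"
    using base(1) by (auto simp: positive_base_set_def complete_graph_def P1_def char_seq_iff)
  have \<E>': "finite E" "E \<subseteq> ytuples M \<phi>" "fin_consistent M \<phi> (A \<union> E)" if "E \<in> \<E>" for E
    using \<E>(2) that by (auto simp: extenders_def)
  then have "\<forall>E\<in>\<E>. \<exists>es. set es = E" using finite_list by blast
  from bchoice[OF this] obtain l where l: "\<And>E. E \<in> \<E> \<Longrightarrow> set (l E) = E" by blast
  obtain Es where Es: "set Es = \<E>" using finite_list[OF \<E>(1)] by blast
  define F where "F = map (\<lambda>E. Yvar # map Par (l E)) Es"
  define B where "B = \<Union>(set ` \<Union>\<E>)"
  have loc: "loc_set M \<phi> F = neighbours M \<phi> \<E>"
  proof -
    have "char_seq M \<phi> (length (Yvar # map Par (l E))) (map (loc_val y) (Yvar # map Par (l E)))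
        \<longleftrightarrow> consistent M \<phi> (insert y E)"
      if "E \<in> \<E>" "y \<in> ytuples M \<phi>" for E y
      using that l[OF that(1)] \<E>'(2)[OF that(1)] by (simp add: char_seq_iff image_image comp_def)
    then show ?thesis by (auto simp: loc_set_def neighbours_def F_def Es)
  qed
  have "A \<subseteq> neighbours M \<phi> \<E>"
    using AY \<E>' by (auto simp: neighbours_def fin_consistent_def)
  moreover have "complete_graph M \<phi> k A" for k using base(1) by (simp add: positive_base_set_def)
  moreover have "c \<noteq> [] \<and> (\<forall>b. Par b \<in> set c \<longrightarrow> b \<in> tuples B (length (yvars \<phi>)))"
    if "c \<in> set F" for c
  proof -
    obtain E where E: "E \<in> \<E>" "c = Yvar # map Par (l E)" using \<open>c \<in> set F\<close> Es by (auto simp: F_def)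
    have "b \<in> tuples B (length (yvars \<phi>))" if "b \<in> E" for b
      using that E(1) \<E>'(2)[OF E(1)] by (auto simp: B_def tuples_def ytuples_def)
    then show ?thesis using E l by auto
  qed
  ultimately have "is_localization M \<phi> A B F"
    using base(2) unfolding is_localization_def loc by blast
  moreover have "finite B" using \<E>(1) \<E>'(1) by (auto simp: B_def)
  moreover have "B \<subseteq> Univ M" using \<E>'(2) by (fastforce simp: B_def ytuples_def tuples_def)
  ultimately show ?thesis using loc by blast
qed

lemma persistent_over_empty:
  assumes base: "positive_base_set M \<phi> A" "A \<noteq> {}"
    and pers: "empty_tuples_persistent M \<phi> n A"
  shows "persistent_over M \<phi> A n {}"
  unfolding persistent_over_def
proof (intro conjI allI impI)
  show "{} \<in> extenders M \<phi> A"
    using fin_consistent_base[OF base(1)] by (simp add: extenders_def)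
  fix \<E> assume "finite \<E> \<and> \<E> \<subseteq> extenders M \<phi> A"
  with ex_localization[OF base] obtain B F where "finite B \<and> B \<subseteq> Univ M \<and> is_localization M \<phi> A B F"
    and F: "loc_set M \<phi> F \<subseteq> neighbours M \<phi> \<E>" by meson
  with pers obtain zs where zs: "empty_tuple M \<phi> n zs" "set zs \<subseteq> loc_set M \<phi> F"
    unfolding empty_tuples_persistent_def by blast
  then have "length zs = n" "\<not> consistent M \<phi> (set zs)"
    by (auto simp: empty_tuple_def char_seq_iff loc_set_def)
  then show "\<exists>zs. length zs = n \<and> set zs \<subseteq> neighbours M \<phi> \<E> \<and> \<not> consistent M \<phi> ({} \<union> set zs)"
    using zs(2) F by auto
qed

lemma positive_base_set_singleton:
  assumes "y \<in> P1 M \<phi>" shows "positive_base_set M \<phi> {y}"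
proof -
  obtain a where "y \<in> ytuples M \<phi>" "a \<in> xtuples M \<phi>" "holds M \<phi> a y"
    using assms by (auto simp: P1_def char_seq_def)
  then have "char_seq M \<phi> (length zs) zs" if "set zs \<subseteq> {y}" for zs
    using that by (auto simp: char_seq_def)
  then show ?thesis using assms by (auto simp: positive_base_set_def complete_graph_def)
qed

text \<open>A larger set has fewer localizations around it.\<close>

lemma empty_tuples_persistent_mono:
  assumes "empty_tuples_persistent M \<phi> n A" "A \<subseteq> A'"
  shows "empty_tuples_persistent M \<phi> n A'"
proof -
  have "is_localization M \<phi> A B F" if "is_localization M \<phi> A' B F" for B F
    using that assms(2) unfolding is_localization_def by blast
  then show ?thesis using assms(1) unfolding empty_tuples_persistent_def by blast
qed

text \<open>Persistence around \<open>A\<close> yields persistence of length \<open>n\<close> over the empty set, hence the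
  independence property.\<close>

theorem theorem6p17:
  fixes L :: "('f, 'r) lang"
    and T :: "('f, 'r) fm set"
    and M :: "('m, 'f, 'r) interp"
    and \<kappa> :: "'k rel"
    and \<phi> :: "('f, 'r) pform"
    and A :: "'m list set"
  assumes complete: "complete_theory L T"
    and model: "is_structure L M" "is_model M T"
    and monster: "Card_order \<kappa>" "(card_of (formulas L), \<kappa>) \<in> ordLess" "saturated L \<kappa> M"
    and phi: "is_pform L \<phi>" "standing_convention L T \<phi>" "P1 M \<phi> \<noteq> {}"
    and nip: "NIP M \<phi>"
    and base: "positive_base_set M \<phi> A"
    and small: "(card_of A, \<kappa>) \<in> ordLess"
  shows "\<forall>n. \<not> empty_tuples_persistent M \<phi> n A"
proof (intro allI notI)
  fix n assume pers: "empty_tuples_persistent M \<phi> n A"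
  obtain y where y: "y \<in> P1 M \<phi>" using phi(3) by blast
  \<comment> \<open>An empty \<open>A\<close> would not witness the nontriviality of localizations, a single point does.\<close>
  define A' where "A' = (if A = {} then {y} else A)"
  have A': "A \<subseteq> A'" "A' \<noteq> {}" by (auto simp: A'_def)
  have base': "positive_base_set M \<phi> A'"
    using base positive_base_set_singleton[OF y] by (simp add: A'_def)
  have "(card_of {y}, \<kappa>) \<in> ordLess"
    by (rule finite_card_of_less[OF _ monster(1) infinite_Field_of_large[OF monster(1,2)]]) simp
  then have small': "(card_of A', \<kappa>) \<in> ordLess" using small by (simp add: A'_def)
  have "A' \<subseteq> ytuples M \<phi>"
    using base' by (auto simp: positive_base_set_def complete_graph_def P1_def char_seq_iff)
  moreover have "persistent_over M \<phi> A' n {}"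
    by (rule persistent_over_empty[OF base' A'(2) empty_tuples_persistent_mono[OF pers A'(1)]])
  ultimately have "has_IP M \<phi>"
    using has_IP_of_persistent_over[OF model(1) phi(1) monster _ small'] by blast
  with nip show False by blast
qed

end
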